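(* Consider the chance-constrained stochastic optimal control problem $$\min_{u(\cdot)}\; C(x_0,t_0,u(\cdot))\quad\text{s.t.}\quad dx=f\,dt+Gu\,dt+\Sigma\,dw,\;\; x(t_0)=x_0,\qquad P_{\mathrm{fail}}(x_0,t_0,u(\cdot))\le\Delta ,$$ and suppose: (1) there exists a constant $\lambda>0$ such that $\Sigma(x,t)\Sigma^\top(x,t)=\lambda\,G(x,t)R^{-1}(x,t)G^\top(x,t)$ for all $(x,t)\in\overline{\mathcal Q}$ (so that for each $\eta\ge 0$ there is a unique optimal policy $u^*(\cdot\,;\eta)$ of the problem $g(\eta)=\min_{u(\cdot)}\mathcal L(x_0,t_0,u(\cdot);\eta)$); (2) there exists a policy $\widetilde u(\cdot)$ with $P_{\mathrm{fail}}(x_0,t_0,\widetilde u(\cdot))-\Delta<0$; (3) the function $\eta\mapsto P_{\mathrm{fail}}(x_0,t_0,u^*(\cdot\,;\eta)):[0,\infty)\to[0,1]$ is continuous. Then there exists a dual optimal solution $0\le\eta^*<\infty$ that maximizes $g(\eta)$ over $\eta\ge 0$, and the unique optimal policy $u^*(\cdot\,;\eta^* )$ of the problem $\min_{u(\cdot)}\mathcal L(x_0,t_0,u(\cdot);\eta^* )$ is an optimal policy of the chance-constrained problem, with $C(x_0,t_0,u^*(\cdot\,;\eta^* ))=g(\eta^* )$; i.e., the duality gap is zero.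
   Context: $\mathcal X_s\subseteq\mathbb R^n$ is a bounded open set (safe region) with boundary $\partial\mathcal X_s$ and closure $\overline{\mathcal X_s}$; $t_0<T$; $\mathcal Q=\mathcal X_s\times[t_0,T)$, $\partial\mathcal Q=(\partial\mathcal X_s\times[t_0,T])\cup(\mathcal X_s\times\{T\})$, $\overline{\mathcal Q}=\overline{\mathcal X_s}\times[t_0,T]$. $w$ is a $k$-dimensional standard Wiener process on a probability space $(\Omega,\mathcal F,P)$. The controlled process satisfies $dx(t)=f(x(t),t)dt+G(x(t),t)u(x(t),t)dt+\Sigma(x(t),t)dw(t)$, with $f\in\mathbb R^n$, $G\in\mathbb R^{n\times m}$, $\Sigma\in\mathbb R^{n\times k}$; coefficients are assumed regular enough that unique strong solutions exist; $x_0\in\overline{\mathcal X_s}$. Admissible policies $u(\cdot)$ are measurable with respect to the $\sigma$-algebra generated by the past states. $\mathbb E_{x_0,t_0}$ and $P_{x_0,t_0}$ denote conditioning on $x(t_0)=x_0$. The exit time is $t_f=\inf\{t>t_0:(x(t),t)\notin\mathcal Q\}$. The probability of failure is $P_{\mathrm{fail}}(x_0,t_0,u(\cdot))=P_{x_0,t_0}\big(\bigvee_{t\in(t_0,T]}x(t)\notin\mathcal X_s\big)=\mathbb E_{x_0,t_0}[\mathbf 1_{x(t_f)\in\partial\mathcal X_s}]$. $\Delta\in(0,1)$ is a given risk tolerance. The cost is $$C(x_0,t_0,u(\cdot))=\mathbb E_{x_0,t_0}\Big[\psi(x(t_f))\mathbf 1_{x(t_f)\in\mathcal X_s}+\int_{t_0}^{t_f}\big(\tfrac12u^\top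 R(x(t),t)u+V(x(t),t)\big)dt\Big],$$ with terminal cost $\psi$, running state cost $V$, and $R(x,t)\in\mathbb R^{m\times m}$ positive definite for all $(x,t)$. For $\eta\ge0$ the Lagrangian is $\mathcal L(x_0,t_0,u(\cdot);\eta)=C(x_0,t_0,u(\cdot))+\eta P_{\mathrm{fail}}(x_0,t_0,u(\cdot))-\eta\Delta$, and the dual function is $g(\eta)=\min_{u(\cdot)}\mathcal L(x_0,t_0,u(\cdot);\eta)$. *)

theory Defs
  imports "HOL-Probability.Probability"
begin

section \<open>Wiener process and Ito integral\<close>

definition history ::
    "'a set \<Rightarrow> (real \<Rightarrow> 'a \<Rightarrow> 'b::topological_space) \<Rightarrow> real \<Rightarrow> real \<Rightarrow> 'a set set" where
  "history \<Omega> X a t = {X s -` B \<inter> \<Omega> | s B. a \<le> s \<and> s \<le> t \<and> B \<in> sets borel}"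

text \<open>Only increments after the initial time \<open>a\<close> matter, so the process is normalised to
  start from \<open>0\<close> at time \<open>a\<close>.\<close>

definition wiener_process :: "'w measure \<Rightarrow> real \<Rightarrow> (real \<Rightarrow> 'w \<Rightarrow> real^'k) \<Rightarrow> bool" where
  "wiener_process M a W \<longleftrightarrow>
     (\<forall>t\<ge>a. W t \<in> borel_measurable M) \<and>
     (AE \<omega> in M. W a \<omega> = 0) \<and>
     (\<forall>\<omega>\<in>space M. continuous_on {a..} (\<lambda>t. W t \<omega>)) \<and>
     (\<forall>s n. a \<le> s 0 \<and> mono s \<longrightarrow>
        prob_space.indep_vars M (\<lambda>_. borel) (\<lambda>i \<omega>. W (s (Suc i)) \<omega> - W (s i) \<omega>) {..<n::nat}) \<and>
     (\<forall>s t. a \<le> s \<and> s < t \<longrightarrow>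
        prob_space.indep_vars M (\<lambda>_. borel) (\<lambda>j \<omega>. (W t \<omega> - W s \<omega>) $ j) UNIV \<and>
        (\<forall>j. distributed M lborel (\<lambda>\<omega>. (W t \<omega> - W s \<omega>) $ j) (normal_density 0 (sqrt (t - s)))))"

definition noise_filtration ::
    "'w measure \<Rightarrow> real \<Rightarrow> (real \<Rightarrow> 'w \<Rightarrow> real^'k) \<Rightarrow> real \<Rightarrow> 'w measure" where
  "noise_filtration M a W t = sigma (space M) (history (space M) W a t \<union> null_sets M)"

definition simple_process ::
    "nat \<Rightarrow> (nat \<Rightarrow> real) \<Rightarrow> (nat \<Rightarrow> 'w \<Rightarrow> real^'k^'n) \<Rightarrow> real \<Rightarrow> 'w \<Rightarrow> real^'k^'n" where
  "simple_process N s \<xi> t \<omega> = (\<Sum>i<N. indicat_real {s i<..s (Suc i)} t *\<^sub>R \<xi> i \<omega>)"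

definition simple_process_data ::
    "'w measure \<Rightarrow> real \<Rightarrow> real \<Rightarrow> (real \<Rightarrow> 'w \<Rightarrow> real^'k) \<Rightarrow>
     nat \<Rightarrow> (nat \<Rightarrow> real) \<Rightarrow> (nat \<Rightarrow> 'w \<Rightarrow> real^'k^'n) \<Rightarrow> bool" where
  "simple_process_data M a b W N s \<xi> \<longleftrightarrow>
     (\<forall>i\<le>N. a \<le> s i \<and> s i \<le> b) \<and>
     (\<forall>i<N. s i \<le> s (Suc i)) \<and>
     (\<forall>i<N. \<xi> i \<in> borel_measurable (noise_filtration M a W (s i)) \<and> bounded (\<xi> i ` space M))"

definition simple_integral_process ::
    "(real \<Rightarrow> 'w \<Rightarrow> real^'k) \<Rightarrow> nat \<Rightarrow> (nat \<Rightarrow> real) \<Rightarrow> (nat \<Rightarrow> 'w \<Rightarrow> real^'k^'n) \<Rightarrow>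
     real \<Rightarrow> 'w \<Rightarrow> real^'n" where
  "simple_integral_process W N s \<xi> t \<omega> =
     (\<Sum>i<N. \<xi> i \<omega> *v (W (min t (s (Suc i))) \<omega> - W (min t (s i)) \<omega>))"

text \<open>\<open>I\<close> is a continuous version of the Ito integral \<open>t \<mapsto> \<integral>\<^sub>a\<^sup>t H dW\<close> on \<open>[a,b]\<close>: simple
  processes \<open>H\<^sub>n\<close> exist with \<open>\<integral>\<^sub>a\<^sup>b |H\<^sub>n - H|\<^sup>2 dt \<rightarrow> 0\<close> in probability (Frobenius norm) and with
  elementary integrals converging to \<open>I t\<close> in probability for each \<open>t\<close>. This determines \<open>I\<close>
  up to indistinguishability. The two measurability conditions on \<open>H\<close> make the events below
  measurable.\<close>

definition ito_integral ::
    "'w measure \<Rightarrow> real \<Rightarrow> real \<Rightarrow> (real \<Rightarrow> 'w \<Rightarrow> real^'k) \<Rightarrow>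
     (real \<Rightarrow> 'w \<Rightarrow> real^'k^'n) \<Rightarrow> (real \<Rightarrow> 'w \<Rightarrow> real^'n) \<Rightarrow> bool" where
  "ito_integral M a b W H I \<longleftrightarrow>
     (\<lambda>(t, \<omega>). H t \<omega>) \<in> borel_measurable (restrict_space borel {a..b} \<Otimes>\<^sub>M M) \<and>
     (\<forall>t\<in>{a..b}. H t \<in> borel_measurable (noise_filtration M a W t)) \<and>
     (AE \<omega> in M. (\<integral>\<^sup>+t\<in>{a..b}. ennreal ((norm (H t \<omega>))\<^sup>2) \<partial>lborel) < \<infinity>) \<and>
     (\<forall>t\<in>{a..b}. I t \<in> borel_measurable (noise_filtration M a W t)) \<and>
     (\<forall>\<omega>\<in>space M. continuous_on {a..b} (\<lambda>t. I t \<omega>)) \<and>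
     (\<exists>N s \<xi>.
        (\<forall>n. simple_process_data M a b W (N n) (s n) (\<xi> n)) \<and>
        (\<forall>\<epsilon>>0. (\<lambda>n. measure M {\<omega>\<in>space M. ennreal \<epsilon> \<le>
            (\<integral>\<^sup>+t\<in>{a..b}. ennreal ((norm (simple_process (N n) (s n) (\<xi> n) t \<omega> - H t \<omega>))\<^sup>2) \<partial>lborel)})
          \<longlonglongrightarrow> 0) \<and>
        (\<forall>\<epsilon>>0. \<forall>t\<in>{a..b}. (\<lambda>n. measure M {\<omega>\<in>space M. \<epsilon> \<le>
            norm (simple_integral_process W (N n) (s n) (\<xi> n) t \<omega> - I t \<omega>)})
          \<longlonglongrightarrow> 0))"

section \<open>The control problem\<close>

record ('w, 'n::finite, 'm::finite, 'k::finite) soc =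
  base_space :: "'w measure"
  noise :: "real \<Rightarrow> 'w \<Rightarrow> real^'k"
  init_time :: real
  final_time :: real
  init_state :: "real^'n"
  safe_set :: "(real^'n) set"
  drift_coeff :: "real^'n \<Rightarrow> real \<Rightarrow> real^'n"
  control_coeff :: "real^'n \<Rightarrow> real \<Rightarrow> real^'m^'n"
  noise_coeff :: "real^'n \<Rightarrow> real \<Rightarrow> real^'k^'n"
  control_weight :: "real^'n \<Rightarrow> real \<Rightarrow> real^'m^'m"
  state_cost :: "real^'n \<Rightarrow> real \<Rightarrow> real"
  terminal_cost :: "real^'n \<Rightarrow> real"

definition positive_definite :: "real^'m^'m \<Rightarrow> bool" where
  "positive_definite A \<longleftrightarrow> transpose A = A \<and> (\<forall>v. v \<noteq> 0 \<longrightarrow> 0 < v \<bullet> (A *v v))"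

definition soc_problem :: "('w, 'n::finite, 'm::finite, 'k::finite) soc \<Rightarrow> bool" where
  "soc_problem P \<longleftrightarrow>
     prob_space (base_space P) \<and>
     wiener_process (base_space P) (init_time P) (noise P) \<and>
     init_time P < final_time P \<and>
     open (safe_set P) \<and> bounded (safe_set P) \<and>
     init_state P \<in> closure (safe_set P) \<and>
     (\<forall>x. \<forall>t\<in>{init_time P..final_time P}. positive_definite (control_weight P x t))"

text \<open>A policy maps a state path and a time to a control value. Markov feedback
  \<open>\<phi> (x(t), t)\<close> is the special case \<open>\<lambda>p t. \<phi> (p t) t\<close>.\<close>

type_synonym ('n, 'm) policy = "(real \<Rightarrow> real^'n) \<Rightarrow> real \<Rightarrow> real^'m"

definition state_paths :: "real \<Rightarrow> real \<Rightarrow> (real \<Rightarrow> real^'n) set" where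
  "state_paths a b = {p. continuous_on {a..b} p}"

definition path_filtration :: "real \<Rightarrow> real \<Rightarrow> real \<Rightarrow> (real \<Rightarrow> real^'n) measure" where
  "path_filtration a b t = sigma (state_paths a b) (history (state_paths a b) (\<lambda>s p. p s) a t)"

definition past_measurable :: "real \<Rightarrow> real \<Rightarrow> ('n::finite, 'm::finite) policy \<Rightarrow> bool" where
  "past_measurable a b u \<longleftrightarrow>
     (\<forall>t\<in>{a..b}. (\<lambda>p. u p t) \<in> borel_measurable (path_filtration a b t)) \<and>
     (\<lambda>(t, p). u p t) \<in> borel_measurable (restrict_space borel {a..b} \<Otimes>\<^sub>M path_filtration a b b)"

definition closed_loop_drift ::
    "('w, 'n::finite, 'm::finite, 'k::finite) soc \<Rightarrow> ('n, 'm) policy \<Rightarrow>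
     (real \<Rightarrow> real^'n) \<Rightarrow> real \<Rightarrow> real^'n" where
  "closed_loop_drift P u p t = drift_coeff P (p t) t + control_coeff P (p t) t *v u p t"

definition strong_solution ::
    "('w, 'n::finite, 'm::finite, 'k::finite) soc \<Rightarrow> ('n, 'm) policy \<Rightarrow>
     (real \<Rightarrow> 'w \<Rightarrow> real^'n) \<Rightarrow> bool" where
  "strong_solution P u X \<longleftrightarrow>
     (let M = base_space P; a = init_time P; b = final_time P in
      (\<forall>t\<in>{a..b}. X t \<in> borel_measurable (noise_filtration M a (noise P) t)) \<and>
      (\<forall>\<omega>\<in>space M. continuous_on {a..b} (\<lambda>t. X t \<omega>)) \<and>
      (AE \<omega> in M. set_integrable lborel {a..b} (closed_loop_drift P u (\<lambda>s. X s \<omega>))) \<and>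
      (\<exists>I. ito_integral M a b (noise P) (\<lambda>t \<omega>. noise_coeff P (X t \<omega>) t) I \<and>
         (AE \<omega> in M. \<forall>t\<in>{a..b}.
            X t \<omega> = init_state P
              + (LINT s:{a..t}|lborel. closed_loop_drift P u (\<lambda>r. X r \<omega>) s) + I t \<omega>)))"

definition uniquely_solvable ::
    "('w, 'n::finite, 'm::finite, 'k::finite) soc \<Rightarrow> ('n, 'm) policy \<Rightarrow> bool" where
  "uniquely_solvable P u \<longleftrightarrow>
     (\<exists>X. strong_solution P u X) \<and>
     (\<forall>X Y. strong_solution P u X \<and> strong_solution P u Y \<longrightarrow>
        (AE \<omega> in base_space P. \<forall>t\<in>{init_time P..final_time P}. X t \<omega> = Y t \<omega>))"

text \<open>For uniquely solvable policies the choice is immaterial up to indistinguishability.\<close>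

definition state ::
    "('w, 'n::finite, 'm::finite, 'k::finite) soc \<Rightarrow> ('n, 'm) policy \<Rightarrow> real \<Rightarrow> 'w \<Rightarrow> real^'n" where
  "state P u = (SOME X. strong_solution P u X)"

definition control ::
    "('w, 'n::finite, 'm::finite, 'k::finite) soc \<Rightarrow> ('n, 'm) policy \<Rightarrow> real \<Rightarrow> 'w \<Rightarrow> real^'m" where
  "control P u t \<omega> = u (\<lambda>s. state P u s \<omega>) t"

definition first_exit :: "real \<Rightarrow> real \<Rightarrow> (real^'n) set \<Rightarrow> (real \<Rightarrow> real^'n) \<Rightarrow> real" where
  "first_exit a b S p = Inf {t. a < t \<and> (p t, t) \<notin> S \<times> {a..<b}}"

text \<open>By this lemma, failure within \<open>(a,b]\<close> is the same event as exit through the boundary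
  of the safe set.\<close>

lemma first_exit_frontier_iff:
  assumes ab: "a < b" and S: "open S" and p: "continuous_on {a..b} p" and pa: "p a \<in> closure S"
  shows "(\<exists>t\<in>{a<..b}. p t \<notin> S) \<longleftrightarrow> p (first_exit a b S p) \<in> frontier S"
proof -
  define E where "E = {t. a < t \<and> (p t, t) \<notin> S \<times> {a..<b}}"
  define \<tau> where "\<tau> = Inf E"
  have bE: "b \<in> E" and bdd: "bdd_below E" using ab by (auto simp: E_def intro: bdd_belowI[of _ a])
  have a\<tau>: "a \<le> \<tau>" unfolding \<tau>_def using bE by (intro cInf_greatest) (auto simp: E_def)
  have \<tau>b: "\<tau> \<le> b" unfolding \<tau>_def using bE bdd by (rule cInf_lower)
  have before: "p t \<in> S" if "a < t" "t < \<tau>" for t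
  proof -
    have "t \<notin> E" using cInf_lower[OF _ bdd, of t] that \<tau>_def by auto
    then show ?thesis using that \<tau>b by (auto simp: E_def)
  qed
  have after: "\<exists>e\<in>E. e < c" if "\<tau> < c" for c
    using cInf_lessD[of E c] that bE unfolding \<tau>_def by blast
  have fr: "frontier S = closure S - S" using S by (simp add: frontier_def interior_open)
  have "p \<tau> \<in> frontier S" if ex: "\<exists>t\<in>{a<..b}. p t \<notin> S"
  proof -
    have "p \<tau> \<in> closure S"
    proof (cases "\<tau> = a")
      case False
      have "p ` closure {a<..<\<tau>} \<subseteq> closure S"
        using False a\<tau> \<tau>b before closure_subset
        by (intro image_closure_subset) (auto intro!: continuous_on_subset[OF p] subsetD[OF closure_subset])
      then show ?thesis using False a\<tau> by auto
    qed (use pa in simp)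
    moreover have "p \<tau> \<notin> S"
    proof
      assume "p \<tau> \<in> S"
      then obtain r where r: "0 < r" "ball (p \<tau>) r \<subseteq> S" using S open_contains_ball by blast
      obtain d where d: "0 < d" "\<And>t. t \<in> {a..b} \<Longrightarrow> dist t \<tau> < d \<Longrightarrow> dist (p t) (p \<tau>) < r"
        using p a\<tau> \<tau>b r(1) unfolding continuous_on_iff by (meson atLeastAtMost_iff)
      have near: "p t \<in> S" if "t \<in> {a..b}" "dist t \<tau> < d" for t
        using d(2)[OF that] r(2) by (auto simp: dist_commute)
      show False
      proof (cases "\<tau> = b")
        case True
        then show False using ex before \<open>p \<tau> \<in> S\<close> by (metis greaterThanAtMost_iff order_le_less)
      next
        case False
        then obtain e where e: "e \<in> E" "e < min (\<tau> + d) b" using after[of "min (\<tau> + d) b"] \<tau>b d(1) by auto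
        have "\<tau> \<le> e" using cInf_lower[OF e(1) bdd] \<tau>_def by simp
        then have "p e \<in> S" using e a\<tau> by (intro near) (auto simp: dist_real_def)
        then show False using e by (auto simp: E_def)
      qed
    qed
    ultimately show ?thesis by (simp add: fr)
  qed
  moreover have "\<exists>t\<in>{a<..b}. p t \<notin> S" if "p \<tau> \<in> frontier S"
  proof (cases "\<tau> = a")
    case True
    then obtain e where "e \<in> E" "e < b" using after ab by auto
    then show ?thesis by (auto simp: E_def)
  next
    case False
    then show ?thesis using that a\<tau> \<tau>b by (auto simp: fr)
  qed
  ultimately show ?thesis unfolding first_exit_def \<tau>_def E_def by blast
qed

definition exit_time ::
    "('w, 'n::finite, 'm::finite, 'k::finite) soc \<Rightarrow> ('n, 'm) policy \<Rightarrow> 'w \<Rightarrow> real" where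
  "exit_time P u \<omega> = first_exit (init_time P) (final_time P) (safe_set P) (\<lambda>t. state P u t \<omega>)"

definition P_fail ::
    "('w, 'n::finite, 'm::finite, 'k::finite) soc \<Rightarrow> ('n, 'm) policy \<Rightarrow> real" where
  "P_fail P u = measure (base_space P)
     {\<omega> \<in> space (base_space P). \<exists>t\<in>{init_time P<..final_time P}. state P u t \<omega> \<notin> safe_set P}"

definition running_cost ::
    "('w, 'n::finite, 'm::finite, 'k::finite) soc \<Rightarrow> ('n, 'm) policy \<Rightarrow> real \<Rightarrow> 'w \<Rightarrow> real" where
  "running_cost P u t \<omega> =
     1/2 * (control P u t \<omega> \<bullet> (control_weight P (state P u t \<omega>) t *v control P u t \<omega>))
     + state_cost P (state P u t \<omega>) t"

definition pathwise_cost ::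
    "('w, 'n::finite, 'm::finite, 'k::finite) soc \<Rightarrow> ('n, 'm) policy \<Rightarrow> 'w \<Rightarrow> real" where
  "pathwise_cost P u \<omega> =
     (let x\<^sub>f = state P u (exit_time P u \<omega>) \<omega> in terminal_cost P x\<^sub>f * indicat_real (safe_set P) x\<^sub>f)
     + (LINT t:{init_time P..exit_time P u \<omega>}|lborel. running_cost P u t \<omega>)"

definition cost ::
    "('w, 'n::finite, 'm::finite, 'k::finite) soc \<Rightarrow> ('n, 'm) policy \<Rightarrow> real" where
  "cost P u = (\<integral>\<omega>. pathwise_cost P u \<omega> \<partial>base_space P)"

text \<open>Integrability is part of admissibility because the Bochner integral of a non-integrable
  function is \<open>0\<close>.\<close>

definition admissible ::
    "('w, 'n::finite, 'm::finite, 'k::finite) soc \<Rightarrow> ('n, 'm) policy \<Rightarrow> bool" where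
  "admissible P u \<longleftrightarrow>
     past_measurable (init_time P) (final_time P) u \<and>
     uniquely_solvable P u \<and>
     (AE \<omega> in base_space P.
        set_integrable lborel {init_time P..exit_time P u \<omega>} (\<lambda>t. running_cost P u t \<omega>)) \<and>
     integrable (base_space P) (pathwise_cost P u)"

text \<open>Values of a policy on null sets and after the exit time have no influence on the problem,
  so uniqueness of an optimal policy is understood modulo the following relation.\<close>

definition same_policy ::
    "('w, 'n::finite, 'm::finite, 'k::finite) soc \<Rightarrow> ('n, 'm) policy \<Rightarrow> ('n, 'm) policy \<Rightarrow> bool" where
  "same_policy P u v \<longleftrightarrow>
     (AE \<omega> in base_space P.
        exit_time P u \<omega> = exit_time P v \<omega> \<and>
        (\<forall>t\<in>{init_time P..exit_time P u \<omega>}. state P u t \<omega> = state P v t \<omega>) \<and>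
        (AE t in lborel. t \<in> {init_time P..exit_time P u \<omega>} \<longrightarrow> control P u t \<omega> = control P v t \<omega>))"

definition lagrangian ::
    "('w, 'n::finite, 'm::finite, 'k::finite) soc \<Rightarrow> real \<Rightarrow> ('n, 'm) policy \<Rightarrow> real \<Rightarrow> real" where
  "lagrangian P \<Delta> u \<eta> = cost P u + \<eta> * P_fail P u - \<eta> * \<Delta>"

definition lagrangian_optimal ::
    "('w, 'n::finite, 'm::finite, 'k::finite) soc \<Rightarrow> real \<Rightarrow> real \<Rightarrow> ('n, 'm) policy \<Rightarrow> bool" where
  "lagrangian_optimal P \<Delta> \<eta> u \<longleftrightarrow>
     admissible P u \<and> (\<forall>v. admissible P v \<longrightarrow> lagrangian P \<Delta> u \<eta> \<le> lagrangian P \<Delta> v \<eta>)"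

definition unique_lagrangian_optimal ::
    "('w, 'n::finite, 'm::finite, 'k::finite) soc \<Rightarrow> real \<Rightarrow> real \<Rightarrow> ('n, 'm) policy \<Rightarrow> bool" where
  "unique_lagrangian_optimal P \<Delta> \<eta> u \<longleftrightarrow>
     lagrangian_optimal P \<Delta> \<eta> u \<and> (\<forall>v. lagrangian_optimal P \<Delta> \<eta> v \<longrightarrow> same_policy P v u)"

text \<open>\<open>LEAST\<close> rather than \<open>INF\<close>: the dual function is an attained minimum.\<close>

definition dual_function ::
    "('w, 'n::finite, 'm::finite, 'k::finite) soc \<Rightarrow> real \<Rightarrow> real \<Rightarrow> real" where
  "dual_function P \<Delta> \<eta> = (LEAST c. \<exists>u. admissible P u \<and> c = lagrangian P \<Delta> u \<eta>)"

definition chance_constrained_optimal ::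
    "('w, 'n::finite, 'm::finite, 'k::finite) soc \<Rightarrow> real \<Rightarrow> ('n, 'm) policy \<Rightarrow> bool" where
  "chance_constrained_optimal P \<Delta> u \<longleftrightarrow>
     admissible P u \<and> P_fail P u \<le> \<Delta> \<and>
     (\<forall>v. admissible P v \<and> P_fail P v \<le> \<Delta> \<longrightarrow> cost P u \<le> cost P v)"

end

theory Submission
  imports Defs
begin

text \<open>Write \<open>p \<eta>\<close> for the failure probability of the \<open>\<eta>\<close>-optimal policy. As \<open>\<eta>\<close> grows, comparison
  with a strictly feasible policy and the lower bound \<open>g(0)\<close> on the cost force \<open>p \<eta> \<le> \<Delta>\<close>. So either
  \<open>p 0 \<le> \<Delta>\<close>, or \<open>p \<eta>\<^sub>0 = \<Delta>\<close> for some \<open>\<eta>\<^sub>0 > 0\<close> by the intermediate value theorem. In both cases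
  the pair of policy and multiplier is feasible and satisfies complementary slackness
  \<open>\<eta>\<^sub>0 (p \<eta>\<^sub>0 - \<Delta>) = 0\<close>, and is therefore a saddle point of the Lagrangian.\<close>

lemma ex_complementary_multiplier:
  fixes c p :: "'u \<Rightarrow> real" and d :: real and v :: "real \<Rightarrow> 'u"
  assumes mem: "\<And>\<eta>. 0 \<le> \<eta> \<Longrightarrow> v \<eta> \<in> A"
    and opt: "\<And>\<eta> u. 0 \<le> \<eta> \<Longrightarrow> u \<in> A \<Longrightarrow> c (v \<eta>) + \<eta> * p (v \<eta>) \<le> c u + \<eta> * p u"
    and slater: "u\<^sub>0 \<in> A" "p u\<^sub>0 < d"
    and cont: "continuous_on {0..} (\<lambda>\<eta>. p (v \<eta>))"
  obtains \<eta>\<^sub>0 where "0 \<le> \<eta>\<^sub>0" "p (v \<eta>\<^sub>0) \<le> d" "\<eta>\<^sub>0 * (p (v \<eta>\<^sub>0) - d) = 0"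
proof (cases "p (v 0) \<le> d")
  case True
  then show thesis by (intro that[of 0]) auto
next
  case False
  \<comment> \<open>By \<open>opt\<close> at 0, \<open>c (v 0)\<close> is the least cost on
    \<open>A\<close>, so \<open>K\<close> is the most that any member can save against
    \<open>u\<^sub>0\<close>.\<close>
  define K where "K = c u\<^sub>0 - c (v 0)"
  \<comment> \<open>Chosen so that the penalty advantage \<open>h * (d - p u\<^sub>0)\<close> of
    \<open>u\<^sub>0\<close> outweighs \<open>K\<close>; the 1 keeps \<open>h\<close> positive when
    \<open>K = 0\<close>.\<close>
  define h where "h = K / (d - p u\<^sub>0) + 1"
  have "0 \<le> K" using opt[of 0 u\<^sub>0] slater by (simp add: K_def)
  then have h: "0 < h" "K \<le> h * (d - p u\<^sub>0)"
    using slater(2) by (simp_all add: h_def distrib_right add_nonneg_pos)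
  have "c (v h) + h * p (v h) \<le> c u\<^sub>0 + h * p u\<^sub>0" using opt[of h u\<^sub>0] h slater by simp
  moreover have "c (v 0) \<le> c (v h)" using opt[of 0 "v h"] mem h by simp
  ultimately have "h * p (v h) \<le> h * d" using h(2) by (simp add: K_def algebra_simps)
  then have "p (v h) \<le> d" using h(1) by simp
  then obtain x where "0 \<le> x" "p (v x) = d"
    using IVT2'[of "\<lambda>\<eta>. p (v \<eta>)" h d 0] False h(1) continuous_on_subset[OF cont, of "{0..h}"]
    by auto
  then show thesis by (intro that[of x]) auto
qed

lemma dual_function_eq:
  assumes "lagrangian_optimal P \<Delta> \<eta> u"
  shows "dual_function P \<Delta> \<eta> = lagrangian P \<Delta> u \<eta>"
  unfolding dual_function_def
  by (rule Least_equality) (use assms in \<open>auto simp: lagrangian_optimal_def\<close>)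

text \<open>Weak duality: at a feasible policy the penalty is nonpositive.\<close>

lemma lagrangian_le_cost:
  assumes "0 \<le> \<eta>" and "P_fail P u \<le> \<Delta>"
  shows "lagrangian P \<Delta> u \<eta> \<le> cost P u"
  using mult_left_mono[OF assms(2,1)] by (simp add: lagrangian_def)

theorem theorem3:
  fixes P :: "('w, 'n::finite, 'm::finite, 'k::finite) soc"
    and \<Delta> :: real
    and ustar :: "real \<Rightarrow> ('n, 'm) policy"
  assumes "soc_problem P"
    and "0 < \<Delta>" and "\<Delta> < 1"
    and "\<exists>lam>0. \<forall>x\<in>closure (safe_set P). \<forall>t\<in>{init_time P..final_time P}.
           noise_coeff P x t ** transpose (noise_coeff P x t) =
           lam *\<^sub>R (control_coeff P x t ** matrix_inv (control_weight P x t)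
                   ** transpose (control_coeff P x t))"
    and "\<forall>\<eta>\<ge>0. unique_lagrangian_optimal P \<Delta> \<eta> (ustar \<eta>)"
    and "\<exists>u. admissible P u \<and> P_fail P u - \<Delta> < 0"
    and "continuous_on {0..} (\<lambda>\<eta>. P_fail P (ustar \<eta>))"
  shows "\<exists>\<eta>\<^sub>0\<ge>0.
           (\<forall>\<eta>\<ge>0. dual_function P \<Delta> \<eta> \<le> dual_function P \<Delta> \<eta>\<^sub>0) \<and>
           chance_constrained_optimal P \<Delta> (ustar \<eta>\<^sub>0) \<and>
           cost P (ustar \<eta>\<^sub>0) = dual_function P \<Delta> \<eta>\<^sub>0"
proof -
  have opt: "lagrangian_optimal P \<Delta> \<eta> (ustar \<eta>)" if "0 \<le> \<eta>" for \<eta>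
    using assms(5) that by (simp add: unique_lagrangian_optimal_def)
  then have adm: "admissible P (ustar \<eta>)"
    and le: "admissible P u \<Longrightarrow> lagrangian P \<Delta> (ustar \<eta>) \<eta> \<le> lagrangian P \<Delta> u \<eta>"
    if "0 \<le> \<eta>" for \<eta> u
    using that by (auto simp: lagrangian_optimal_def)
  obtain u\<^sub>0 where "admissible P u\<^sub>0" "P_fail P u\<^sub>0 < \<Delta>" using assms(6) by auto
  then obtain \<eta>\<^sub>0 where \<eta>\<^sub>0: "0 \<le> \<eta>\<^sub>0" "P_fail P (ustar \<eta>\<^sub>0) \<le> \<Delta>"
      "\<eta>\<^sub>0 * (P_fail P (ustar \<eta>\<^sub>0) - \<Delta>) = 0"
    using ex_complementary_multiplier[of ustar "{u. admissible P u}" "cost P" "P_fail P" u\<^sub>0 \<Delta>]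
      adm le assms(7) by (auto simp: lagrangian_def)
  \<comment> \<open>Complementary slackness cancels the penalty.\<close>
  have gap: "cost P (ustar \<eta>\<^sub>0) = lagrangian P \<Delta> (ustar \<eta>\<^sub>0) \<eta>\<^sub>0"
    using \<eta>\<^sub>0(3) by (simp add: lagrangian_def right_diff_distrib)
  have dual: "cost P (ustar \<eta>\<^sub>0) = dual_function P \<Delta> \<eta>\<^sub>0"
    using gap dual_function_eq[OF opt[OF \<eta>\<^sub>0(1)]] by simp
  \<comment> \<open>The feasible policy \<open>ustar \<eta>\<^sub>0\<close> serves as competitor at
    every \<open>\<eta>\<close>, so its cost bounds the whole dual function.\<close>
  have "dual_function P \<Delta> \<eta> \<le> dual_function P \<Delta> \<eta>\<^sub>0" if "0 \<le> \<eta>" for \<eta>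
    using le[OF that adm[OF \<eta>\<^sub>0(1)]] lagrangian_le_cost[OF that \<eta>\<^sub>0(2)]
      dual_function_eq[OF opt[OF that]] dual by simp
  \<comment> \<open>Minimality at \<open>\<eta>\<^sub>0\<close>, then weak duality for
    \<open>v\<close>.\<close>
  moreover have "cost P (ustar \<eta>\<^sub>0) \<le> cost P v" if "admissible P v" "P_fail P v \<le> \<Delta>" for v
    using gap le[OF \<eta>\<^sub>0(1) that(1)] lagrangian_le_cost[OF \<eta>\<^sub>0(1) that(2)] by simp
  ultimately show ?thesis
    using \<eta>\<^sub>0 adm dual by (auto simp: chance_constrained_optimal_def)
qed

end
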